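(* Let $q\ge 4$ be a power of $2$ and let $\mathcal{D}(q)$ be a quasi-symmetric design of Blokhuis-Haemers type. Let $G$ be an automorphism group of $\mathcal{D}(q)$ acting on $\mathcal{D}(q)$ with $f$ fixed points and $h$ fixed blocks, and all other orbits (of points and of blocks) of size $2$, and let $M$ be the point orbit matrix of $\mathcal{D}(q)$ with respect to $G$. Then the binary linear code spanned by the columns of the non-fixed part of the point orbit matrix $M$ is a doubly even self-orthogonal code.
   Context: A $2$-$(v,k,\lambda)$ design is a finite incidence structure $(\mathcal{P},\mathcal{B},\mathcal{I})$ with $v$ points, each block incident with exactly $k$ points, and any two distinct points incident with exactly $\lambda$ common blocks; it is symmetric if the number of blocks equals $v$. For $0\le s<k$, $s$ is a block intersection number if there are two blocks with exactly $s$ common points; the design is quasi-symmetric if it has exactly two block intersection numbers $x<y$. An automorphism group of a design $\mathcal{D}$ is a subgroup $G\le \mathrm{Aut}(\mathcal{D})$, acting on points and on blocks and preserving incidence. Designs of Blokhuis-Haemers type: let $q$ be a power of $2$. Let $\mathcal{D}_1$ be a symmetric $2$-$(q^2,q(q-1)/2,q(q-2)/4)$ design whose blocks are maximal arcs in the affine plane $AG(2,q)$ (sets of $q(q-1)/2$ points meeting every line in $0$ or $q/2$ points), and let $\mathcal{D}_2$ be the resolvable $2$-$(q^3,q,1)$ design of points and lines of $AG(3,q)$. For every parallel class $P$ of $q^2$ lines of $AG(3,q)$, label the lines in $P$ by the points of $\mathcal{D}_1$, and for each block $B$ of $\mathcal{D}_1$ define a block of the new design as the union of the $q(q-1)/2$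 lines of $P$ labelled by the points of $B$; here the labelling is such that the sets of lines labelled by blocks of $\mathcal{D}_1$ are maximal arcs in the quotient affine plane $AG(2,q)$ whose points are the lines of $P$ (and whose lines are given by the planes of $AG(3,q)$ that are unions of lines of $P$). The points of the new design are the points of $AG(3,q)$, and its blocks are all the blocks obtained in this way from all parallel classes. The resulting design $\mathcal{D}(q)$ is called a design of Blokhuis-Haemers type. It is known (Blokhuis and Haemers) that $\mathcal{D}(q)$ is a quasi-symmetric $2$-$(q^3,\,q^2(q-1)/2,\,q(q^3-q^2-2)/4)$ design with block intersection numbers $x=q^2(q-2)/4$ and $y=q^2(q-1)/4$. Orbit matrices: let $\mathcal{P}_1,\dots,\mathcal{P}_{t_v}$ be the $G$-orbits of points and $\mathcal{B}_1,\dots,\mathcal{B}_{t_b}$ the $G$-orbits of blocks. The point orbit matrix with respect to $G$ is the $t_v\times t_b$ matrix $M=(\gamma_{ij})$, where $\gamma_{ij}$ is the number of blocks of $\mathcal{B}_j$ incident with a representative of $\mathcal{P}_i$ (independent of the representative). The non-fixed part of $M$ is the submatrix formed by the rows corresponding to non-fixed points (point orbits of size greater than $1$) and the columns corresponding to non-fixed blocks (block orbits of size greater than $1$); its entries are read in $\mathbb{F}_2$ (reduced modulo $2$). A binary code is doubly even if all codewords have weight divisible by $4$, and self-orthogonal if $C\subseteq C^\perp$ for the standard inner product. *)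

theory Defs
  imports
    "HOL-Analysis.Cartesian_Space"
    "HOL-Algebra.Group_Action"
    "HOL-Combinatorics.Permutations"
    "HOL-Library.Z2"
    "HOL-Library.Function_Algebras"
    "HOL-Library.Numeral_Type"
begin

record ('p, 'b) incidence_structure =
  points :: "'p set"
  blocks :: "'b set"
  incid :: "'p \<Rightarrow> 'b \<Rightarrow> bool"

definition two_design :: "('p, 'b) incidence_structure \<Rightarrow> nat \<Rightarrow> nat \<Rightarrow> nat \<Rightarrow> bool" where
  "two_design D v k l \<longleftrightarrow>
     finite (points D) \<and> finite (blocks D) \<and> card (points D) = v \<and>
     (\<forall>B\<in>blocks D. card {p \<in> points D. incid D p B} = k) \<and>
     (\<forall>p\<in>points D. \<forall>p'\<in>points D. p \<noteq> p' \<longrightarrow>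
        card {B \<in> blocks D. incid D p B \<and> incid D p' B} = l)"

definition symmetric_two_design :: "('p, 'b) incidence_structure \<Rightarrow> nat \<Rightarrow> nat \<Rightarrow> nat \<Rightarrow> bool" where
  "symmetric_two_design D v k l \<longleftrightarrow> two_design D v k l \<and> card (blocks D) = v"

definition block_intersection_numbers :: "('p, 'b) incidence_structure \<Rightarrow> nat \<Rightarrow> nat set" where
  "block_intersection_numbers D k =
     {s. s < k \<and> (\<exists>B\<in>blocks D. \<exists>C\<in>blocks D. B \<noteq> C \<and>
            card {p \<in> points D. incid D p B \<and> incid D p C} = s)}"

definition quasi_symmetric_design :: "('p, 'b) incidence_structure \<Rightarrow> bool" where
  "quasi_symmetric_design D \<longleftrightarrow>
     (\<exists>v k l. two_design D v k l \<and>
        (\<exists>x y. x < y \<and> block_intersection_numbers D k = {x, y}))"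

text \<open>An automorphism is a permutation of the points together with a permutation of the blocks.
  As \<open>permutes\<close> makes both components the identity outside the points and blocks,
  distinct elements of the carrier are distinct automorphisms.\<close>

definition Aut ::
  "('p, 'b) incidence_structure \<Rightarrow> (('p \<Rightarrow> 'p) \<times> ('b \<Rightarrow> 'b)) monoid" where
  "Aut D =
     \<lparr> carrier = {(\<alpha>, \<beta>). \<alpha> permutes points D \<and> \<beta> permutes blocks D \<and>
                    (\<forall>p\<in>points D. \<forall>B\<in>blocks D. incid D (\<alpha> p) (\<beta> B) \<longleftrightarrow> incid D p B)},
       monoid.mult = (\<lambda>(\<alpha>, \<beta>) (\<alpha>', \<beta>'). (\<alpha> \<circ> \<alpha>', \<beta> \<circ> \<beta>')),
       monoid.one = (id, id) \<rparr>"

definition fixed_points ::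
  "('p, 'b) incidence_structure \<Rightarrow> (('p \<Rightarrow> 'p) \<times> ('b \<Rightarrow> 'b)) set \<Rightarrow> 'p set" where
  "fixed_points D G = {p \<in> points D. \<forall>g\<in>G. fst g p = p}"

definition fixed_blocks ::
  "('p, 'b) incidence_structure \<Rightarrow> (('p \<Rightarrow> 'p) \<times> ('b \<Rightarrow> 'b)) set \<Rightarrow> 'b set" where
  "fixed_blocks D G = {B \<in> blocks D. \<forall>g\<in>G. snd g B = B}"

definition point_orbits ::
  "('p, 'b) incidence_structure \<Rightarrow> (('p \<Rightarrow> 'p) \<times> ('b \<Rightarrow> 'b)) set \<Rightarrow> 'p set set" where
  "point_orbits D G = orbits (Aut D\<lparr>carrier := G\<rparr>) (points D) fst"

definition block_orbits ::
  "('p, 'b) incidence_structure \<Rightarrow> (('p \<Rightarrow> 'p) \<times> ('b \<Rightarrow> 'b)) set \<Rightarrow> 'b set set" where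
  "block_orbits D G = orbits (Aut D\<lparr>carrier := G\<rparr>) (blocks D) snd"

definition nonfixed_point_orbits ::
  "('p, 'b) incidence_structure \<Rightarrow> (('p \<Rightarrow> 'p) \<times> ('b \<Rightarrow> 'b)) set \<Rightarrow> 'p set set" where
  "nonfixed_point_orbits D G = {P \<in> point_orbits D G. card P > 1}"

definition nonfixed_block_orbits ::
  "('p, 'b) incidence_structure \<Rightarrow> (('p \<Rightarrow> 'p) \<times> ('b \<Rightarrow> 'b)) set \<Rightarrow> 'b set set" where
  "nonfixed_block_orbits D G = {B \<in> block_orbits D G. card B > 1}"

text \<open>Rows and columns are indexed by the orbits themselves rather than by an enumeration of them.
  The group enters only through the index sets: the matrix consists of the entries with
  row index in \<open>point_orbits D G\<close> and column index in \<open>block_orbits D G\<close>.\<close>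

definition point_orbit_matrix ::
  "('p, 'b) incidence_structure \<Rightarrow> 'p set \<Rightarrow> 'b set \<Rightarrow> nat" where
  "point_orbit_matrix D P \<B> = card {B \<in> \<B>. incid D (SOME p. p \<in> P) B}"

text \<open>A binary word with finite coordinate set \<open>I\<close> is a function to \<^typ>\<open>bit\<close>, the field with
  two elements, that vanishes outside \<open>I\<close>. The group structure on words is the pointwise one.\<close>

definition column_code :: "'i set \<Rightarrow> 'j set \<Rightarrow> ('i \<Rightarrow> 'j \<Rightarrow> bit) \<Rightarrow> ('i \<Rightarrow> bit) set" where
  "column_code I J A =
     module.span (\<lambda>c w i. c * w i) ((\<lambda>j i. if i \<in> I then A i j else 0) ` J)"

definition weight :: "'i set \<Rightarrow> ('i \<Rightarrow> bit) \<Rightarrow> nat" where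
  "weight I c = card {i \<in> I. c i \<noteq> 0}"

definition doubly_even :: "'i set \<Rightarrow> ('i \<Rightarrow> bit) set \<Rightarrow> bool" where
  "doubly_even I C \<longleftrightarrow> (\<forall>c\<in>C. 4 dvd weight I c)"

definition dual_code :: "'i set \<Rightarrow> ('i \<Rightarrow> bit) set \<Rightarrow> ('i \<Rightarrow> bit) set" where
  "dual_code I C = {w. (\<forall>i. i \<notin> I \<longrightarrow> w i = 0) \<and> (\<forall>c\<in>C. (\<Sum>i\<in>I. w i * c i) = 0)}"

definition self_orthogonal :: "'i set \<Rightarrow> ('i \<Rightarrow> bit) set \<Rightarrow> bool" where
  "self_orthogonal I C \<longleftrightarrow> C \<subseteq> dual_code I C"

definition flats :: "nat \<Rightarrow> ('a::{field,finite} ^ 'n) set set" where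
  "flats m = {(+) p ` W | p W. vec.subspace W \<and> vec.dim W = m}"

definition parallel_classes :: "('a::{field,finite} ^ 'n) set set set" where
  "parallel_classes = {{(+) p ` W | p. True} | W. vec.subspace W \<and> vec.dim W = 1}"

definition affine_plane :: "('a::{field,finite} ^ 2, ('a ^ 2) set) incidence_structure" where
  "affine_plane = \<lparr> points = UNIV, blocks = flats 1, incid = (\<in>) \<rparr>"

definition quotient_plane ::
  "('a::{field,finite} ^ 3) set set \<Rightarrow> (('a ^ 3) set, ('a ^ 3) set) incidence_structure" where
  "quotient_plane P =
     \<lparr> points = P, blocks = {E \<in> flats 2. \<exists>S\<subseteq>P. E = \<Union>S}, incid = (\<subseteq>) \<rparr>"

definition maximal_arc :: "nat \<Rightarrow> ('p, 'l) incidence_structure \<Rightarrow> 'p set \<Rightarrow> bool" where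
  "maximal_arc q A S \<longleftrightarrow>
     S \<subseteq> points A \<and> card S = q * (q - 1) div 2 \<and>
     (\<forall>l\<in>blocks A. card {p \<in> S. incid A p l} \<in> {0, q div 2})"

text \<open>\<open>D1\<close> is the symmetric design, and \<open>lab P\<close> sends a point of \<open>D1\<close>
  to the line of \<open>P\<close> that it labels.\<close>

definition blokhuis_haemers ::
  "('a::{field,finite} ^ 2, ('a ^ 2) set) incidence_structure \<Rightarrow>
   (('a ^ 3) set set \<Rightarrow> 'a ^ 2 \<Rightarrow> ('a ^ 3) set) \<Rightarrow>
   ('a ^ 3, ('a ^ 3) set) incidence_structure" where
  "blokhuis_haemers D1 lab =
     \<lparr> points = UNIV,
       blocks = {\<Union>(lab P ` {x \<in> points D1. incid D1 x B}) | P B.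
                   P \<in> parallel_classes \<and> B \<in> blocks D1},
       incid = (\<in>) \<rparr>"

definition blokhuis_haemers_type ::
  "nat \<Rightarrow> ('a::{field,finite} ^ 3, ('a ^ 3) set) incidence_structure \<Rightarrow> bool" where
  "blokhuis_haemers_type q D \<longleftrightarrow>
     (\<exists>(D1 :: ('a ^ 2, ('a ^ 2) set) incidence_structure) lab.
        symmetric_two_design D1 (q\<^sup>2) (q * (q - 1) div 2) (q * (q - 2) div 4) \<and>
        points D1 = points affine_plane \<and> incid D1 = (\<in>) \<and>
        (\<forall>B\<in>blocks D1. maximal_arc q affine_plane B) \<and>
        (\<forall>P\<in>parallel_classes.
           bij_betw (lab P) (points D1) P \<and>
           (\<forall>B\<in>blocks D1. maximal_arc q (quotient_plane P) (lab P ` B))) \<and>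
        D = blokhuis_haemers D1 lab)"

end

theory Submission
  imports Defs
begin

text \<open>
  The proof separates into a divisibility statement about the design and an argument that applies to
  any finite incidence structure satisfying it. The divisibility statement is that any two blocks of
  \<open>\<D>(q)\<close>, equal or not, share a number of points divisible by \<open>4\<close>
  (\<open>four_dvd_block_intersection\<close>). Two blocks built from the same parallel class share a union of
  parallel lines, hence a multiple of \<open>q\<close> points. For two blocks built from different classes, cut
  the space into the planes spanned by the two directions: in each plane either block consists of
  \<open>0\<close> or \<open>q/2\<close> parallel lines, so the two share \<open>0\<close> or \<open>q\<^sup>2/4\<close> points of the plane.

  Now let \<open>{B, B'}\<close> be a block orbit. A point orbit has an odd entry in its column exactly when its
  points lie in the symmetric difference of \<open>B\<close> and \<open>B'\<close>. This symmetric difference is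
  invariant and contains no fixed point, because some group element exchanges \<open>B\<close> and \<open>B'\<close>; so it
  is a union of point orbits of size \<open>2\<close>, and the weight of the column is half its size, that is
  \<open>|B| - |B \<inter> B'|\<close>, a multiple of \<open>4\<close>. Likewise the columns of \<open>{B, B'}\<close> and \<open>{C, C'}\<close>
  have inner product half the size of the intersection of the two symmetric differences. By
  inclusion and exclusion that size is congruent modulo \<open>4\<close> to
  \<open>|B \<inter> C| + |B \<inter> C'| + |B' \<inter> C| + |B' \<inter> C'|\<close>, in which every term is divisible by \<open>4\<close>, minus
  twice \<open>|B \<inter> B' \<inter> C| + |B \<inter> B' \<inter> C'| + |B \<inter> C \<inter> C'| + |B' \<inter> C \<inter> C'|\<close>. Some group element
  exchanges both pairs at once (\<open>simultaneous_swap\<close>), so the triple intersections come in two pairs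
  of equal size, their sum is even, and the size in question is divisible by \<open>4\<close>. Finally, words of
  weight divisible by \<open>4\<close> that are pairwise orthogonal span a doubly even self-orthogonal code
  (\<open>doubly_even_self_orthogonal_column_code\<close>).
\<close>

section \<open>Doubly even codes from generators\<close>

interpretation word: module "\<lambda>(c::bit) (w::'i \<Rightarrow> bit) i. c * w i"
  by unfold_locales (auto simp: fun_eq_iff algebra_simps)

lemma of_nat_bit_eq_0_iff: "(of_nat n :: bit) = 0 \<longleftrightarrow> even n"
  by (simp only: Z2.bit_eq_iff even_of_nat even_zero simp_thms)

lemma of_nat_card_bit_inner_product:
  fixes x y :: "'i \<Rightarrow> bit"
  assumes "finite I"
  shows "(\<Sum>i\<in>I. x i * y i) = of_nat (card {i \<in> I. x i \<noteq> 0 \<and> y i \<noteq> 0})"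
proof -
  have "(\<Sum>i\<in>I. x i * y i) = (\<Sum>i\<in>I. if x i \<noteq> 0 \<and> y i \<noteq> 0 then 1 else 0)"
    by (rule sum.cong) auto
  also have "\<dots> = of_nat (card {i \<in> I. x i \<noteq> 0 \<and> y i \<noteq> 0})"
    using assms by (simp add: sum.If_cases Int_def)
  finally show ?thesis .
qed

lemma weight_add:
  fixes x y :: "'i \<Rightarrow> bit"
  assumes "finite I"
  shows "weight I (x + y) + 2 * card {i \<in> I. x i \<noteq> 0 \<and> y i \<noteq> 0} = weight I x + weight I y"
proof -
  have card_sum: "card {i \<in> I. Q i} = (\<Sum>i\<in>I. of_bool (Q i))" for Q
    using assms by (simp add: Int_def)
  show ?thesis
    unfolding weight_def card_sum sum_distrib_left sum.distrib[symmetric]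
    by (rule sum.cong) auto
qed

text \<open>Orthogonality to the generators is linear, so it passes to the whole span. Adding a generator
  to a codeword then subtracts twice the size of an even overlap from the sum of the weights, which
  keeps the weight divisible by \<open>4\<close>.\<close>

lemma doubly_even_self_orthogonal_column_code:
  fixes A :: "'i \<Rightarrow> 'j \<Rightarrow> bit"
  assumes I: "finite I"
    and wt: "\<And>j. j \<in> J \<Longrightarrow> 4 dvd card {i \<in> I. A i j \<noteq> 0}"
    and orth: "\<And>j k. j \<in> J \<Longrightarrow> k \<in> J \<Longrightarrow> even (card {i \<in> I. A i j \<noteq> 0 \<and> A i k \<noteq> 0})"
  shows "doubly_even I (column_code I J A) \<and> self_orthogonal I (column_code I J A)"
proof -
  define S where "S = (\<lambda>j i. if i \<in> I then A i j else 0) ` J"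
  define ip where "ip x y = (\<Sum>i\<in>I. x i * y i)" for x y :: "'i \<Rightarrow> bit"
  have ip_0: "ip x y = 0 \<longleftrightarrow> even (card {i \<in> I. x i \<noteq> 0 \<and> y i \<noteq> 0})" for x y
    unfolding ip_def of_nat_card_bit_inner_product[OF I] of_nat_bit_eq_0_iff ..
  have C: "column_code I J A = word.span S"
    unfolding column_code_def S_def ..
  have wtS: "4 dvd weight I s" if "s \<in> S" for s
  proof -
    from that obtain j where "j \<in> J" "s = (\<lambda>i. if i \<in> I then A i j else 0)"
      by (auto simp: S_def)
    moreover from this have "{i \<in> I. s i \<noteq> 0} = {i \<in> I. A i j \<noteq> 0}" by auto
    ultimately show ?thesis using wt by (simp add: weight_def)
  qed
  have ipS: "ip s t = 0" if st: "s \<in> S" "t \<in> S" for s t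
  proof -
    from st obtain j k where jk: "j \<in> J" "s = (\<lambda>i. if i \<in> I then A i j else 0)"
      "k \<in> J" "t = (\<lambda>i. if i \<in> I then A i k else 0)"
      by (auto simp: S_def)
    then have "{i \<in> I. s i \<noteq> 0 \<and> t i \<noteq> 0} = {i \<in> I. A i j \<noteq> 0 \<and> A i k \<noteq> 0}" by auto
    then show ?thesis using orth jk by (simp only: ip_0)
  qed
  have ip_scale: "ip (\<lambda>i. c * x i) z = c * ip x z" for c x z
    unfolding ip_def sum_distrib_left by (simp only: mult.assoc)
  have ip_add: "ip (x + y) z = ip x z + ip y z" for x y z
    unfolding ip_def by (simp only: plus_fun_apply distrib_right sum.distrib)
  have ip_commute: "ip x y = ip y x" for x y
    unfolding ip_def by (simp only: mult.commute)
  have ip_zero: "ip 0 z = 0" for z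
    unfolding ip_def by (simp only: zero_fun_apply mult_zero_left sum.neutral_const)
  have subspace_perp: "word.subspace {w. \<forall>c\<in>T. ip w c = 0}" for T
    by (simp add: word.subspace_def ip_add ip_zero ip_scale del: mult_bit_eq_and)
  have "word.span S \<subseteq> {w. \<forall>c\<in>S. ip w c = 0}"
    using ipS by (intro word.span_minimal subspace_perp) auto
  then have perp: "ip w s = 0" if "w \<in> word.span S" "s \<in> S" for w s
    using that by auto
  have "word.span S \<subseteq> {w. \<forall>c\<in>word.span S. ip w c = 0}"
    using perp ip_commute by (intro word.span_minimal subspace_perp) fastforce
  moreover have "word.span S \<subseteq> {w. \<forall>i. i \<notin> I \<longrightarrow> w i = 0}"
    by (intro word.span_minimal) (auto simp: S_def word.subspace_def simp del: mult_bit_eq_and)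
  ultimately have so: "self_orthogonal I (word.span S)"
    by (auto simp: self_orthogonal_def dual_code_def ip_def)
  have "w \<in> word.span S \<and> 4 dvd weight I w" if "w \<in> word.span S" for w
    using that
  proof (induction rule: word.span_induct_alt)
    case base
    show ?case using word.span_zero[of S] by (simp only: weight_def) simp
  next
    case (step c x y)
    show ?case
    proof (cases "c = 0")
      case True
      then have "(\<lambda>i. c * x i) + y = y" by (simp add: fun_eq_iff)
      with step show ?thesis by simp
    next
      case False
      then have sum: "(\<lambda>i. c * x i) + y = x + y" by (simp add: fun_eq_iff)
      have "ip x y = 0" using step perp[of y x] ip_commute[of x y] by simp
      then have "even (card {i \<in> I. x i \<noteq> 0 \<and> y i \<noteq> 0})" by (simp only: ip_0)
      moreover have "4 dvd weight I x" "4 dvd weight I y" using wtS step by auto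
      ultimately have "4 dvd weight I (x + y)" using weight_add[OF I, of x y] by presburger
      moreover have "x + y \<in> word.span S"
        using step by (intro word.span_add[OF word.span_base]) simp_all
      ultimately show ?thesis unfolding sum by blast
    qed
  qed
  with so show ?thesis by (simp add: C doubly_even_def)
qed

section \<open>Orbits of size two\<close>

locale two_orbit_group =
  fixes D :: "('p, 'b) incidence_structure" and G :: "(('p \<Rightarrow> 'p) \<times> ('b \<Rightarrow> 'b)) set"
  assumes finite_points: "finite (points D)"
    and subgroup_Aut: "subgroup G (Aut D)"
    and point_orbits_two: "\<forall>P\<in>nonfixed_point_orbits D G. card P = 2"
    and block_orbits_two: "\<forall>\<B>\<in>nonfixed_block_orbits D G. card \<B> = 2"
begin

lemma group_element:
  assumes "g \<in> G"
  shows "fst g permutes points D" "snd g permutes blocks D"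
    "\<And>p B. p \<in> points D \<Longrightarrow> B \<in> blocks D \<Longrightarrow> incid D (fst g p) (snd g B) \<longleftrightarrow> incid D p B"
proof -
  have "g \<in> carrier (Aut D)" using assms subgroup.subset[OF subgroup_Aut] by (rule rev_subsetD)
  then have *: "fst g permutes points D \<and> snd g permutes blocks D
      \<and> (\<forall>p\<in>points D. \<forall>B\<in>blocks D. incid D (fst g p) (snd g B) \<longleftrightarrow> incid D p B)"
    by (simp add: Aut_def case_prod_beta)
  show "fst g permutes points D" "snd g permutes blocks D" using * by simp_all
  show "incid D (fst g p) (snd g B) \<longleftrightarrow> incid D p B" if "p \<in> points D" "B \<in> blocks D" for p B
    using * that by simp
qed

lemma id_mem: "(id, id) \<in> G"
proof -
  have "\<one>\<^bsub>Aut D\<^esub> = (id, id)" by (simp add: Aut_def)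
  then show ?thesis using subgroup.one_closed[OF subgroup_Aut] by argo
qed

lemma mem_orbit_self: "p \<in> {fst g p | g. g \<in> G}" "B \<in> {snd g B | g. g \<in> G}"
  by (rule CollectI exI[of _ "(id, id)"] conjI id_mem | simp)+

lemma comp_mem: "g \<in> G \<Longrightarrow> h \<in> G \<Longrightarrow> (fst g \<circ> fst h, snd g \<circ> snd h) \<in> G"
proof -
  assume "g \<in> G" "h \<in> G"
  then have "g \<otimes>\<^bsub>Aut D\<^esub> h \<in> G" by (rule subgroup.m_closed[OF subgroup_Aut])
  moreover have "g \<otimes>\<^bsub>Aut D\<^esub> h = (fst g \<circ> fst h, snd g \<circ> snd h)"
    by (simp add: Aut_def case_prod_beta)
  ultimately show "(fst g \<circ> fst h, snd g \<circ> snd h) \<in> G" by argo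
qed

lemma point_orbits_eq: "point_orbits D G = {{fst g p | g. g \<in> G} | p. p \<in> points D}"
  by (simp add: point_orbits_def orbits_def orbit_def)

lemma block_orbits_eq: "block_orbits D G = {{snd g B | g. g \<in> G} | B. B \<in> blocks D}"
  by (simp add: block_orbits_def orbits_def orbit_def)

text \<open>Each group element acts injectively on an orbit of size \<open>2\<close> and hence fixes or exchanges its two
  elements; the one carrying \<open>B\<close> to \<open>B'\<close> exchanges them.\<close>

lemma block_orbit_elem:
  assumes "\<B> \<in> nonfixed_block_orbits D G"
  obtains B B' where "\<B> = {B, B'}" "B \<noteq> B'" "B \<in> blocks D" "B' \<in> blocks D"
    "\<exists>g\<in>G. snd g B = B' \<and> snd g B' = B"
    "\<And>g. g \<in> G \<Longrightarrow> snd g B = B \<and> snd g B' = B' \<or> snd g B = B' \<and> snd g B' = B"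
proof -
  have c: "card \<B> = 2" using block_orbits_two assms by blast
  have "\<B> \<in> block_orbits D G" using assms by (simp add: nonfixed_block_orbits_def)
  then obtain B where B: "B \<in> blocks D" "\<B> = {snd g B | g. g \<in> G}"
    unfolding block_orbits_eq by blast
  have "B \<in> \<B>" unfolding B(2) by (rule mem_orbit_self)
  with c obtain B' where \<B>: "\<B> = {B, B'}" "B \<noteq> B'"
    by (auto simp: card_2_iff)
  have "B' \<in> \<B>" by (simp add: \<B>)
  then have "B' \<in> {snd g B | g. g \<in> G}" by (simp only: B(2))
  then obtain g where g: "g \<in> G" "snd g B = B'" by blast
  have closed: "snd h X \<in> {B, B'}" if h: "h \<in> G" and X: "X \<in> {B, B'}" for h X
  proof -
    have "X \<in> \<B>" using X by (simp only: \<B>)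
    then have "X \<in> {snd g B | g. g \<in> G}" by (simp only: B(2))
    then obtain k where "k \<in> G" "X = snd k B" by blast
    then have "snd h X \<in> \<B>" using comp_mem[OF h, of k] B by force
    then show ?thesis using \<B> by simp
  qed
  have inj: "snd h B \<noteq> snd h B'" if "h \<in> G" for h
    using group_element(2)[OF that] \<B>(2) by (metis permutes_inj injD)
  have alt: "snd h B = B \<and> snd h B' = B' \<or> snd h B = B' \<and> snd h B' = B" if "h \<in> G" for h
    using closed[OF that, of B] closed[OF that, of B'] inj[OF that] by auto
  have "B' \<in> blocks D" using g group_element(2)[OF g(1)] B permutes_in_image by metis
  then show ?thesis using that[OF \<B>(1,2) B(1)] alt g \<B>(2) by metis
qed

text \<open>The orbit of \<open>p\<close> is contained in \<open>P\<close>, and if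
  \<open>p = g a \<noteq> a\<close> it has the two elements \<open>p\<close> and \<open>g p\<close>, so it exhausts \<open>P\<close>.\<close>

lemma point_orbit_eq_of_mem:
  assumes P: "P \<in> nonfixed_point_orbits D G" and p: "p \<in> P"
  shows "P = {fst g p | g. g \<in> G}" "p \<in> points D"
proof -
  have c: "card P = 2" using point_orbits_two P by blast
  have "P \<in> point_orbits D G" using P by (simp add: nonfixed_point_orbits_def)
  then obtain a where a: "a \<in> points D" "P = {fst g a | g. g \<in> G}"
    unfolding point_orbits_eq by blast
  from p a obtain g where g: "g \<in> G" "p = fst g a" by auto
  show "p \<in> points D" using g group_element(1)[OF g(1)] a by (simp add: permutes_in_image)
  have sub: "{fst h p | h. h \<in> G} \<subseteq> P"
    using comp_mem[OF _ g(1)] g(2) a(2) by force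
  show "P = {fst g p | g. g \<in> G}"
  proof (cases "p = a")
    case False
    have "p \<in> {fst h p | h. h \<in> G}" by (rule mem_orbit_self)
    moreover have "fst g p \<in> {fst h p | h. h \<in> G}" using g(1) by blast
    moreover have "fst g p \<noteq> p"
      using False g group_element(1)[OF g(1)] by (metis permutes_inj injD)
    ultimately have "card {p, fst g p} = 2" "{p, fst g p} \<subseteq> {fst h p | h. h \<in> G}" by auto
    then show ?thesis using sub c
      by (metis (no_types, lifting) card_subset_eq card.infinite subset_antisym
          subset_trans zero_neq_numeral)
  qed (use a in simp)
qed

text \<open>Take \<open>g\<close> exchanging \<open>B\<close> and \<open>B'\<close>, and \<open>h\<close> exchanging \<open>C\<close> and \<open>C'\<close>. If \<open>g\<close> fixes \<open>C\<close> and \<open>h\<close>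
  fixes \<open>B\<close>, then the composition of the two exchanges both pairs; otherwise \<open>g\<close> or \<open>h\<close> alone
  does.\<close>

lemma simultaneous_swap:
  assumes "{B, B'} \<in> nonfixed_block_orbits D G" "{C, C'} \<in> nonfixed_block_orbits D G"
    and "B \<noteq> B'" "C \<noteq> C'"
  shows "\<exists>g\<in>G. snd g B = B' \<and> snd g B' = B \<and> snd g C = C' \<and> snd g C' = C"
proof -
  obtain g where g: "g \<in> G" "snd g B = B'" "snd g B' = B"
    using block_orbit_elem[OF assms(1)] by (metis doubleton_eq_iff)
  obtain h where h: "h \<in> G" "snd h C = C'" "snd h C' = C"
    using block_orbit_elem[OF assms(2)] by (metis doubleton_eq_iff)
  have gC: "snd g C = C \<and> snd g C' = C' \<or> snd g C = C' \<and> snd g C' = C"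
    using block_orbit_elem[OF assms(2)] g(1) by (smt (verit) doubleton_eq_iff)
  have hB: "snd h B = B \<and> snd h B' = B' \<or> snd h B = B' \<and> snd h B' = B"
    using block_orbit_elem[OF assms(1)] h(1) by (smt (verit) doubleton_eq_iff)
  from gC hB show ?thesis
    using g h bexI[of _ "(fst g \<circ> fst h, snd g \<circ> snd h)", OF _ comp_mem[OF g(1) h(1)]] by auto
qed

text \<open>For an orbit \<open>\<B> = {B, B'}\<close> this is the symmetric difference of the point sets of \<open>B\<close> and
  \<open>B'\<close>. It is expressed by parity because the orbits of these points are then visibly the rows with
  an odd entry in the column of \<open>\<B>\<close>.\<close>

definition odd_points :: "'b set \<Rightarrow> 'p set" where
  "odd_points \<B> = {p \<in> points D. odd (card {B \<in> \<B>. incid D p B})}"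

lemma odd_points_pair:
  assumes "B \<noteq> B'"
  shows "odd_points {B, B'} = {p \<in> points D. incid D p B \<noteq> incid D p B'}"
proof -
  have "{X \<in> {B, B'}. incid D p X} =
    (if incid D p B then {B} else {}) \<union> (if incid D p B' then {B'} else {})" for p by auto
  then show ?thesis using assms by (auto simp: odd_points_def)
qed

lemma odd_points_invariant:
  assumes "\<B> \<in> nonfixed_block_orbits D G" "g \<in> G" "p \<in> odd_points \<B>"
  shows "fst g p \<in> odd_points \<B>"
proof -
  obtain B B' where *: "\<B> = {B, B'}" "B \<noteq> B'" "B \<in> blocks D" "B' \<in> blocks D"
    "snd g B = B \<and> snd g B' = B' \<or> snd g B = B' \<and> snd g B' = B"
    using block_orbit_elem[OF assms(1)] assms(2) by metis
  from assms(3) have p: "p \<in> points D" "incid D p B \<noteq> incid D p B'"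
    by (simp_all add: * odd_points_pair)
  have "fst g p \<in> points D"
    using group_element(1)[OF assms(2)] p(1) by (simp add: permutes_in_image)
  moreover have "incid D (fst g p) B \<noteq> incid D (fst g p) B'"
    using * p group_element(3)[OF assms(2) p(1)] by metis
  ultimately show ?thesis by (simp add: * odd_points_pair)
qed

text \<open>A fixed point is incident with both blocks of an orbit or with neither, since some group
  element carries one block to the other; so the orbit of a point in the symmetric difference has
  more than one element.\<close>

lemma odd_point_orbit:
  assumes "\<B> \<in> nonfixed_block_orbits D G" "p \<in> odd_points \<B>"
  shows "{fst g p | g. g \<in> G} \<in> nonfixed_point_orbits D G"
proof -
  obtain B B' g where *: "\<B> = {B, B'}" "B \<noteq> B'" "B \<in> blocks D" "B' \<in> blocks D"
    "g \<in> G" "snd g B = B'"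
    using block_orbit_elem[OF assms(1)] by metis
  from assms(2) have p: "p \<in> points D" "incid D p B \<noteq> incid D p B'"
    by (simp_all add: * odd_points_pair)
  let ?O = "{fst g p | g. g \<in> G}"
  have "?O \<subseteq> points D" using group_element(1) p(1) by (auto simp: permutes_in_image)
  then have fin: "finite ?O" using finite_points finite_subset by blast
  have ne: "fst g p \<noteq> p" using group_element(3)[OF *(5) p(1) *(3)] * p by auto
  have "{p, fst g p} \<subseteq> ?O" using mem_orbit_self(1)[of p] *(5) by blast
  then have "card {p, fst g p} \<le> card ?O" by (rule card_mono[OF fin])
  then have "card ?O > 1" using ne by simp
  then show ?thesis using p(1) by (auto simp: nonfixed_point_orbits_def point_orbits_eq)
qed

lemma finite_nonfixed_point_orbits: "finite (nonfixed_point_orbits D G)"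
proof -
  have "nonfixed_point_orbits D G \<subseteq> (\<lambda>p. {fst g p | g. g \<in> G}) ` points D"
    by (auto simp: nonfixed_point_orbits_def point_orbits_eq)
  then show ?thesis using finite_points finite_surj by blast
qed

text \<open>Both the weight of a column and the inner product of two columns count orbits, while the
  design gives information about points; this is the conversion between the two.\<close>

lemma card_union_of_nonfixed_orbits:
  assumes sub: "\<And>p. p \<in> Y \<Longrightarrow> {fst g p | g. g \<in> G} \<in> nonfixed_point_orbits D G"
    and inv: "\<And>g p. g \<in> G \<Longrightarrow> p \<in> Y \<Longrightarrow> fst g p \<in> Y"
  shows "card Y = 2 * card {P \<in> nonfixed_point_orbits D G. (SOME p. p \<in> P) \<in> Y}"
proof -
  let ?I = "nonfixed_point_orbits D G"
  let ?S = "{P \<in> ?I. (SOME p. p \<in> P) \<in> Y}"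
  have some: "(SOME p. p \<in> P) \<in> P" if "P \<in> ?I" for P
  proof -
    have "P \<noteq> {}" using that by (auto simp: nonfixed_point_orbits_def)
    then show ?thesis by (simp add: some_in_eq)
  qed
  have eq: "P = {fst g p | g. g \<in> G}" if "P \<in> ?I" "p \<in> P" for P p
    by (rule point_orbit_eq_of_mem[OF that])
  have card2: "card P = 2" if "P \<in> ?S" for P using that point_orbits_two by auto
  have "\<Union>?S = Y"
  proof
    show "\<Union>?S \<subseteq> Y"
    proof
      fix p assume "p \<in> \<Union>?S"
      then obtain P where P: "P \<in> ?I" "(SOME p. p \<in> P) \<in> Y" "p \<in> P" by auto
      have "p \<in> {fst g (SOME p. p \<in> P) | g. g \<in> G}"
        using eq[OF P(1) some[OF P(1)]] P(3) by blast
      then obtain g where "g \<in> G" "p = fst g (SOME p. p \<in> P)" by blast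
      then show "p \<in> Y" using inv P(2) by simp
    qed
    show "Y \<subseteq> \<Union>?S"
    proof
      fix p assume p: "p \<in> Y"
      let ?O = "{fst g p | g. g \<in> G}"
      have O: "?O \<in> ?I" using sub p .
      have "?O \<subseteq> Y" using inv p by auto
      then have "(SOME p. p \<in> ?O) \<in> Y" using some[OF O] by (rule subsetD)
      with O have "?O \<in> ?S" by (intro CollectI conjI)
      then show "p \<in> \<Union>?S" using mem_orbit_self(1) by (rule UnionI)
    qed
  qed
  moreover have "2 * card ?S = card (\<Union>?S)"
  proof (rule card_partition)
    show "finite ?S" using finite_nonfixed_point_orbits by simp
    show "finite (\<Union>?S)"
    proof (rule finite_Union[OF \<open>finite ?S\<close>])
      fix P assume "P \<in> ?S"
      then have "card P = 2" by (rule card2)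
      then show "finite P" by (simp add: card_ge_0_finite)
    qed
    show "card c = 2" if "c \<in> ?S" for c using that card2 by simp
    show "c1 \<inter> c2 = {}" if c: "c1 \<in> ?S" "c2 \<in> ?S" "c1 \<noteq> c2" for c1 c2
    proof (rule ccontr)
      assume "c1 \<inter> c2 \<noteq> {}"
      then obtain p where "p \<in> c1" "p \<in> c2" by blast
      then have "c1 = c2" using eq[of c1 p] eq[of c2 p] c(1,2) by simp
      with c(3) show False by contradiction
    qed
  qed
  ultimately show ?thesis by simp
qed

lemma card_swap:
  assumes "g \<in> G"
    and "\<And>p. p \<in> points D \<Longrightarrow> R (fst g p) \<longleftrightarrow> Q p"
  shows "card {p \<in> points D. Q p} = card {p \<in> points D. R p}"
proof -
  have perm: "fst g permutes points D" using group_element(1)[OF assms(1)] .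
  have "fst g ` {p \<in> points D. Q p} = {p \<in> points D. R p}"
  proof (intro equalityI subsetI)
    fix y assume y: "y \<in> {p \<in> points D. R p}"
    then have "y \<in> fst g ` points D" using permutes_image[OF perm] by simp
    with y assms(2) show "y \<in> fst g ` {p \<in> points D. Q p}" by auto
  qed (use assms(2) permutes_in_image[OF perm] in auto)
  then show ?thesis
    using card_image[OF inj_on_subset[OF permutes_inj[OF perm] subset_UNIV]] by metis
qed

lemma card_points_sum: "card {p \<in> points D. Q p} = (\<Sum>p\<in>points D. of_bool (Q p))"
  using finite_points by (simp add: Int_def)

text \<open>Half of \<open>|B| + |B'| - 2 |B \<inter> B'|\<close> is \<open>|B| - |B \<inter> B'|\<close>, because the blocks of an orbit have
  equally many points.\<close>

lemma eight_dvd_odd_points: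
  assumes \<B>: "\<B> \<in> nonfixed_block_orbits D G"
    and four: "\<And>B C. B \<in> blocks D \<Longrightarrow> C \<in> blocks D \<Longrightarrow>
        4 dvd card {p \<in> points D. incid D p B \<and> incid D p C}"
  shows "8 dvd card (odd_points \<B>)"
proof -
  obtain B B' g where *: "\<B> = {B, B'}" "B \<noteq> B'" "B \<in> blocks D" "B' \<in> blocks D"
    "g \<in> G" "snd g B = B'"
    using block_orbit_elem[OF \<B>] by metis
  have "card {p \<in> points D. incid D p B \<noteq> incid D p B'}
      + 2 * card {p \<in> points D. incid D p B \<and> incid D p B'}
      = card {p \<in> points D. incid D p B} + card {p \<in> points D. incid D p B'}"
    unfolding card_points_sum sum_distrib_left sum.distrib[symmetric] by (rule sum.cong) auto
  moreover have "card {p \<in> points D. incid D p B} = card {p \<in> points D. incid D p B'}"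
    using group_element(3)[OF *(5) _ *(3)] *(6) by (intro card_swap[OF *(5)]) simp
  moreover have "4 dvd card {p \<in> points D. incid D p B}" using four[of B B] * by simp
  moreover have "4 dvd card {p \<in> points D. incid D p B \<and> incid D p B'}" using four * by simp
  ultimately show ?thesis unfolding * odd_points_pair[OF *(2)] by presburger
qed

text \<open>Inclusion and exclusion leaves twice a sum of four triple intersections; a simultaneous exchange
  of both pairs of blocks matches these in two pairs, which makes the sum even.\<close>

lemma four_dvd_odd_points_Int:
  assumes \<B>: "\<B> \<in> nonfixed_block_orbits D G" and \<C>: "\<C> \<in> nonfixed_block_orbits D G"
    and four: "\<And>B C. B \<in> blocks D \<Longrightarrow> C \<in> blocks D \<Longrightarrow>
        4 dvd card {p \<in> points D. incid D p B \<and> incid D p C}"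
  shows "4 dvd card (odd_points \<B> \<inter> odd_points \<C>)"
proof -
  obtain B B' where b: "\<B> = {B, B'}" "B \<noteq> B'" "B \<in> blocks D" "B' \<in> blocks D"
    using block_orbit_elem[OF \<B>] by metis
  obtain C C' where c: "\<C> = {C, C'}" "C \<noteq> C'" "C \<in> blocks D" "C' \<in> blocks D"
    using block_orbit_elem[OF \<C>] by metis
  obtain g where g: "g \<in> G" "snd g B = B'" "snd g B' = B" "snd g C = C'" "snd g C' = C"
    using simultaneous_swap \<B> \<C> b c by metis
  \<comment> \<open>Writing the counts as functions of the four incidences turns the exchange into a swap of
    arguments.\<close>
  define n where "n Q = card {p \<in> points D. Q (incid D p B) (incid D p B') (incid D p C) (incid D p C')}"
    for Q
  have "odd_points \<B> \<inter> odd_points \<C> =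
      {p \<in> points D. incid D p B \<noteq> incid D p B' \<and> incid D p C \<noteq> incid D p C'}"
    using b c by (auto simp: odd_points_pair)
  then have target: "card (odd_points \<B> \<inter> odd_points \<C>) = n (\<lambda>b b' c c'. b \<noteq> b' \<and> c \<noteq> c')"
    by (simp add: n_def)
  have expand: "n (\<lambda>b b' c c'. b \<noteq> b' \<and> c \<noteq> c')
      + 2 * (n (\<lambda>b b' c c'. b \<and> b' \<and> c) + n (\<lambda>b b' c c'. b \<and> b' \<and> c')
             + n (\<lambda>b b' c c'. b \<and> c \<and> c') + n (\<lambda>b b' c c'. b' \<and> c \<and> c'))
    = n (\<lambda>b b' c c'. b \<and> c) + n (\<lambda>b b' c c'. b \<and> c') + n (\<lambda>b b' c c'. b' \<and> c)
      + n (\<lambda>b b' c c'. b' \<and> c') + 4 * n (\<lambda>b b' c c'. b \<and> b' \<and> c \<and> c')"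
    unfolding n_def card_points_sum sum_distrib_left sum.distrib[symmetric]
    by (rule sum.cong) auto
  have swap: "n Q = n (\<lambda>b b' c c'. Q b' b c' c)" for Q
  proof -
    have "incid D (fst g p) B = incid D p B'" "incid D (fst g p) B' = incid D p B"
      "incid D (fst g p) C = incid D p C'" "incid D (fst g p) C' = incid D p C"
      if "p \<in> points D" for p
      using group_element(3)[OF g(1) that] g b c by metis+
    then show ?thesis unfolding n_def by (intro card_swap[OF g(1), symmetric]) simp
  qed
  have "n (\<lambda>b b' c c'. b \<and> b' \<and> c) = n (\<lambda>b b' c c'. b \<and> b' \<and> c')"
    "n (\<lambda>b b' c c'. b \<and> c \<and> c') = n (\<lambda>b b' c c'. b' \<and> c \<and> c')"
    using swap[of "\<lambda>b b' c c'. b \<and> b' \<and> c"] swap[of "\<lambda>b b' c c'. b \<and> c \<and> c'"]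
    by (simp_all add: conj_ac)
  moreover note expand
  moreover have "4 dvd n (\<lambda>b b' c c'. b \<and> c)" "4 dvd n (\<lambda>b b' c c'. b \<and> c')"
    "4 dvd n (\<lambda>b b' c c'. b' \<and> c)" "4 dvd n (\<lambda>b b' c c'. b' \<and> c')"
    using four b c by (simp_all add: n_def)
  ultimately show ?thesis unfolding target by presburger
qed

text \<open>An entry is odd when the chosen representative of its row is an odd point of its column, so
  the support of a column, and the overlap of two, are sets of orbits whose unions are the sets of
  points counted above, twice as large.\<close>

lemma orbit_matrix_code:
  assumes four: "\<And>B C. B \<in> blocks D \<Longrightarrow> C \<in> blocks D \<Longrightarrow>
        4 dvd card {p \<in> points D. incid D p B \<and> incid D p C}"
  defines "I \<equiv> nonfixed_point_orbits D G"
  defines "C \<equiv> column_code I (nonfixed_block_orbits D G)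
                 (\<lambda>P \<B>. of_nat (point_orbit_matrix D P \<B>))"
  shows "doubly_even I C \<and> self_orthogonal I C"
proof -
  have entry: "(of_nat (point_orbit_matrix D P \<B>) :: bit) \<noteq> 0
      \<longleftrightarrow> (SOME p. p \<in> P) \<in> odd_points \<B>" if "P \<in> I" for P \<B>
  proof -
    have "P \<noteq> {}" using that by (auto simp: I_def nonfixed_point_orbits_def)
    then have "(SOME p. p \<in> P) \<in> P" by (simp add: some_in_eq)
    then have "(SOME p. p \<in> P) \<in> points D"
      using that point_orbit_eq_of_mem(2) by (simp add: I_def)
    then show ?thesis
      by (simp add: of_nat_bit_eq_0_iff point_orbit_matrix_def odd_points_def)
  qed
  show ?thesis
    unfolding C_def
  proof (rule doubly_even_self_orthogonal_column_code)
    show "finite I" unfolding I_def by (rule finite_nonfixed_point_orbits)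
  next
    fix \<B> assume \<B>: "\<B> \<in> nonfixed_block_orbits D G"
    have "{P \<in> I. (of_nat (point_orbit_matrix D P \<B>) :: bit) \<noteq> 0}
        = {P \<in> I. (SOME p. p \<in> P) \<in> odd_points \<B>}" using entry by auto
    moreover have "card (odd_points \<B>) = 2 * card {P \<in> I. (SOME p. p \<in> P) \<in> odd_points \<B>}"
      unfolding I_def using odd_point_orbit[OF \<B>] odd_points_invariant[OF \<B>]
      by (intro card_union_of_nonfixed_orbits)
    ultimately show "4 dvd card {P \<in> I. (of_nat (point_orbit_matrix D P \<B>) :: bit) \<noteq> 0}"
      using eight_dvd_odd_points[OF \<B> four] by presburger
  next
    fix \<B> \<C>
    assume \<B>: "\<B> \<in> nonfixed_block_orbits D G" and \<C>: "\<C> \<in> nonfixed_block_orbits D G"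
    let ?Y = "odd_points \<B> \<inter> odd_points \<C>"
    have "{P \<in> I. (of_nat (point_orbit_matrix D P \<B>) :: bit) \<noteq> 0
          \<and> (of_nat (point_orbit_matrix D P \<C>) :: bit) \<noteq> 0}
        = {P \<in> I. (SOME p. p \<in> P) \<in> ?Y}" using entry by auto
    moreover have "card ?Y = 2 * card {P \<in> I. (SOME p. p \<in> P) \<in> ?Y}"
      unfolding I_def
      using odd_point_orbit[OF \<B>] odd_points_invariant[OF \<B>] odd_points_invariant[OF \<C>]
      by (intro card_union_of_nonfixed_orbits) auto
    ultimately show "even (card {P \<in> I. (of_nat (point_orbit_matrix D P \<B>) :: bit) \<noteq> 0
          \<and> (of_nat (point_orbit_matrix D P \<C>) :: bit) \<noteq> 0})"
      using four_dvd_odd_points_Int[OF \<B> \<C> four] by presburger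
  qed
qed

end

section \<open>Block intersections in designs of Blokhuis-Haemers type\<close>

lemma coset_eq_of_mem:
  fixes W :: "('a::field ^ 'n) set"
  assumes W: "vec.subspace W" and x: "x \<in> (+) p ` W"
  shows "(+) p ` W = (+) x ` W"
proof -
  from x obtain w where w: "w \<in> W" "x = p + w" by auto
  have "p + u = x + (u - w)" "x + u = p + (w + u)" for u by (simp_all add: w)
  moreover have "u - w \<in> W" "w + u \<in> W" if "u \<in> W" for u
    using that w W by (simp_all add: vec.subspace_diff vec.subspace_add)
  ultimately show ?thesis by (metis (no_types, opaque_lifting) image_subset_iff imageI subset_antisym)
qed

lemma coset_class_member_eq:
  fixes W :: "('a::field ^ 'n) set"
  assumes "vec.subspace W" "S \<subseteq> {(+) p ` W | p. True}" "l \<in> S" "x \<in> l"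
  shows "l = (+) x ` W"
proof -
  obtain p where "l = (+) p ` W" using assms(2,3) by blast
  then show ?thesis using coset_eq_of_mem[OF assms(1)] assms(4) by simp
qed

lemma mem_coset_self: "vec.subspace W \<Longrightarrow> x \<in> (+) x ` W"
  using vec.subspace_0 by force

lemma card_one_dim_subspace:
  fixes W :: "('a::{field,finite} ^ 'n) set"
  assumes "vec.subspace W" "vec.dim W = 1"
  obtains d where "d \<noteq> 0" "W = vec.span {d}" "card W = CARD('a)"
proof -
  obtain S where S: "S \<subseteq> W" "vec.independent S" "W \<subseteq> vec.span S" "card S = 1"
    using vec.basis_exists[of W] assms(2) by metis
  then obtain d where d: "S = {d}" by (auto simp: card_1_singleton_iff)
  have "d \<noteq> 0" using S(2) d vec.dependent_zero by auto
  moreover have W: "W = vec.span {d}"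
    using S d assms(1) vec.span_minimal by blast
  moreover have "card W = CARD('a)"
    using \<open>d \<noteq> 0\<close> unfolding W vec.span_singleton by (subst card_image) (auto simp: inj_on_def)
  ultimately show ?thesis using that by blast
qed

lemma dvd_card_Union_cosets:
  fixes W :: "('a::{field,finite} ^ 'n) set"
  assumes "vec.subspace W" "vec.dim W = 1" "S \<subseteq> {(+) p ` W | p. True}"
  shows "CARD('a) dvd card (\<Union>S)"
proof (rule dvd_partition)
  show "finite (\<Union>S)" by simp
  show "\<forall>c\<in>S. CARD('a) dvd card c"
  proof
    fix c assume "c \<in> S"
    then obtain p where "c = (+) p ` W" using assms(3) by blast
    then have "card c = card W" by (simp add: card_image)
    moreover have "card W = CARD('a)" using card_one_dim_subspace[OF assms(1,2)] by blast
    ultimately show "CARD('a) dvd card c" by simp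
  qed
  show "\<forall>c1\<in>S. \<forall>c2\<in>S. c1 \<noteq> c2 \<longrightarrow> c1 \<inter> c2 = {}"
    using coset_class_member_eq[OF assms(1,3)] by blast
qed

text \<open>A point of \<open>E = e + (W + W')\<close> lies on one coset of each of \<open>W\<close> and \<open>W'\<close>, and a coset of \<open>W\<close> in
  \<open>E\<close> meets a coset of \<open>W'\<close> in \<open>E\<close> in one point; so the common points of the two sets in \<open>E\<close>
  correspond to pairs of cosets. For lines \<open>W\<close> and \<open>W'\<close> this is the count in a plane.\<close>

lemma card_Int_plane:
  fixes W W' :: "('a::{field,finite} ^ 'n) set" and e :: "'a ^ 'n"
  assumes W: "vec.subspace W" and W': "vec.subspace W'" and triv: "W \<inter> W' = {0}"
    and S: "S \<subseteq> {(+) p ` W | p. True}" and S': "S' \<subseteq> {(+) p ` W' | p. True}"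
  defines "E \<equiv> (+) e ` {w + w' | w w'. w \<in> W \<and> w' \<in> W'}"
  shows "card (\<Union>S \<inter> \<Union>S' \<inter> E) = card {l \<in> S. l \<subseteq> E} * card {l \<in> S'. l \<subseteq> E}"
proof -
  let ?U = "{w + w' | w w'. w \<in> W \<and> w' \<in> W'}"
  let ?f = "\<lambda>x. ((+) x ` W, (+) x ` W')"
  let ?A = "\<Union>S \<inter> \<Union>S' \<inter> E"
  have U: "vec.subspace ?U" using W W' by (rule vec.subspace_sums)
  have WU: "W \<subseteq> ?U" "W' \<subseteq> ?U"
    using vec.subspace_0[OF W] vec.subspace_0[OF W'] by force+
  have E: "E = (+) x ` ?U" if "x \<in> E" for x
    using coset_eq_of_mem[OF U] that unfolding E_def by blast
  have "inj_on ?f ?A"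
  proof (rule inj_onI)
    fix x y assume "?f x = ?f y"
    then have "x \<in> (+) y ` W" "x \<in> (+) y ` W'"
      using mem_coset_self[OF W, of x] mem_coset_self[OF W', of x] by auto
    then have "x - y \<in> W \<inter> W'" by auto
    then show "x = y" using triv by simp
  qed
  moreover have "?f ` ?A = {l \<in> S. l \<subseteq> E} \<times> {l \<in> S'. l \<subseteq> E}"
  proof (intro equalityI subsetI)
    fix z assume "z \<in> ?f ` ?A"
    then obtain x l l' where x: "z = ?f x" "x \<in> E" "l \<in> S" "x \<in> l" "l' \<in> S'" "x \<in> l'" by auto
    have "l = (+) x ` W" using x coset_class_member_eq[OF W S] by blast
    moreover have "l' = (+) x ` W'" using x coset_class_member_eq[OF W' S'] by blast
    moreover have "(+) x ` W \<subseteq> E" "(+) x ` W' \<subseteq> E" unfolding E[OF x(2)] using WU by auto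
    ultimately show "z \<in> {l \<in> S. l \<subseteq> E} \<times> {l \<in> S'. l \<subseteq> E}" using x by auto
  next
    fix z assume "z \<in> {l \<in> S. l \<subseteq> E} \<times> {l \<in> S'. l \<subseteq> E}"
    then obtain l l' where z: "z = (l, l')" "l \<in> S" "l \<subseteq> E" "l' \<in> S'" "l' \<subseteq> E" by auto
    have "l \<in> {(+) p ` W | p. True}" "l' \<in> {(+) p ` W' | p. True}" using z S S' by auto
    then obtain p p' where p: "l = (+) p ` W" "l' = (+) p' ` W'" by auto
    have pE: "p \<in> E" "p' \<in> E" using z p mem_coset_self[OF W] mem_coset_self[OF W'] by auto
    then obtain w w' where w: "w \<in> W" "w' \<in> W'" "p' = p + (w + w')" using E[of p] by auto
    define x where "x = p + w"
    have x: "x \<in> l" using w p by (simp add: x_def)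
    have "x = p' + (- w')" by (simp add: x_def w)
    then have x': "x \<in> l'" unfolding p by (rule image_eqI[OF _ vec.subspace_neg[OF W' w(2)]])
    have "l = (+) x ` W" "l' = (+) x ` W'"
      using coset_eq_of_mem[OF W] coset_eq_of_mem[OF W'] x x' p by auto
    then show "z \<in> ?f ` ?A" using x x' z by blast
  qed
  ultimately show ?thesis using card_image[of ?f ?A] by (simp only: card_cartesian_product)
qed

lemma dim_sum_of_distinct_lines:
  fixes W W' :: "('a::{field,finite} ^ 'n) set"
  assumes W: "vec.subspace W" "vec.dim W = 1" and W': "vec.subspace W'" "vec.dim W' = 1"
    and ne: "W \<noteq> W'"
  shows "W \<inter> W' = {0}" "vec.dim {w + w' | w w'. w \<in> W \<and> w' \<in> W'} = 2"
proof -
  have sub: "vec.subspace (W \<inter> W')" using W W' by (simp add: vec.subspace_inter)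
  have "vec.dim (W \<inter> W') \<noteq> 1"
  proof
    assume "vec.dim (W \<inter> W') = 1"
    then have "W \<inter> W' = W" "W \<inter> W' = W'"
      using vec.subspace_dim_equal[OF sub W(1) Int_lower1] W
        vec.subspace_dim_equal[OF sub W'(1) Int_lower2] W' by auto
    with ne show False by auto
  qed
  moreover have "vec.dim (W \<inter> W') \<le> 1" using vec.dim_subset[of "W \<inter> W'" W] W by simp
  ultimately have "vec.dim (W \<inter> W') = 0" by linarith
  then have "W \<inter> W' \<subseteq> {0}" by (simp only: vec.dim_eq_0)
  then show "W \<inter> W' = {0}" using vec.subspace_0[OF sub] by blast
  obtain d where d: "d \<noteq> 0" "W = vec.span {d}" using card_one_dim_subspace[OF W] by metis
  obtain d' where d': "d' \<noteq> 0" "W' = vec.span {d'}" using card_one_dim_subspace[OF W'] by metis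
  have "d' \<in> W'" using d' vec.span_base[of d' "{d'}"] by simp
  then have "d' \<notin> vec.span {d}" using \<open>W \<inter> W' = {0}\<close> d d' by auto
  then have "vec.independent {d', d}"
    using d(1) by (intro vec.independent_insertI) (simp_all add: vec.independent_empty)
  moreover have "d' \<noteq> d" using \<open>d' \<notin> vec.span {d}\<close> vec.span_base[of d "{d}"] by auto
  ultimately have "vec.dim {d', d} = 2" using vec.dim_eq_card_independent by fastforce
  moreover have "{w + w' | w w'. w \<in> W \<and> w' \<in> W'} = vec.span ({d} \<union> {d'})"
    unfolding vec.span_Un d d' by blast
  moreover have "{d} \<union> {d'} = {d', d}" by auto
  ultimately show "vec.dim {w + w' | w w'. w \<in> W \<and> w' \<in> W'} = 2"
    by (simp only: vec.dim_span)
qed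

text \<open>This makes the arc property available for every plane parallel to a given direction: it says
  that the plane contains \<open>0\<close> or \<open>q/2\<close> of the lines that make up a block.\<close>

lemma coset_mem_quotient_plane:
  fixes W U :: "('a::{field,finite} ^ 3) set"
  assumes W: "vec.subspace W" and U: "vec.subspace U" "vec.dim U = 2" and sub: "W \<subseteq> U"
  shows "(+) e ` U \<in> blocks (quotient_plane {(+) p ` W | p. True})"
proof -
  let ?S = "{(+) x ` W | x. x \<in> (+) e ` U}"
  have "(+) e ` U = \<Union>?S"
  proof
    show "(+) e ` U \<subseteq> \<Union>?S" using mem_coset_self[OF W] by blast
    show "\<Union>?S \<subseteq> (+) e ` U"
    proof
      fix y assume "y \<in> \<Union>?S"
      then obtain x where x: "x \<in> (+) e ` U" "y \<in> (+) x ` W" by blast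
      then show "y \<in> (+) e ` U" using coset_eq_of_mem[OF U(1) x(1)] sub by auto
    qed
  qed
  moreover have "(+) e ` U \<in> flats 2" using U by (auto simp: flats_def)
  moreover have "?S \<subseteq> {(+) p ` W | p. True}" by blast
  ultimately show ?thesis unfolding quotient_plane_def by (auto intro!: exI[of _ ?S])
qed

text \<open>Blocks from one parallel class meet in a union of its lines, of \<open>q\<close> points each. For blocks
  from two classes the planes parallel to both directions partition the space, and each contains
  an even number of lines of either block because \<open>q/2\<close> is even.\<close>

lemma four_dvd_block_intersection:
  fixes D :: "('a::{field,finite} ^ 3, ('a ^ 3) set) incidence_structure"
  assumes q: "q \<ge> 4" "q = 2 ^ m" "CARD('a) = q"
    and D: "blokhuis_haemers_type q D"
    and B: "B \<in> blocks D" and C: "C \<in> blocks D"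
  shows "4 dvd card (B \<inter> C)"
proof -
  have "m \<ge> 2"
  proof (rule ccontr)
    assume "\<not> m \<ge> 2"
    then have "m = 0 \<or> m = 1" by auto
    then show False using q by auto
  qed
  then obtain n where "m = n + 2" using le_Suc_ex by (metis add.commute)
  then have q4: "q = 4 * 2 ^ n" using q(2) by (simp add: power_add)
  obtain D1 :: "('a ^ 2, ('a ^ 2) set) incidence_structure" and lab where
    lab: "incid D1 = (\<in>)" "points D1 = UNIV"
    "\<And>P. P \<in> parallel_classes \<Longrightarrow> bij_betw (lab P) (points D1) P"
    "\<And>P X. P \<in> parallel_classes \<Longrightarrow> X \<in> blocks D1 \<Longrightarrow> maximal_arc q (quotient_plane P) (lab P ` X)"
    and D_eq: "D = blokhuis_haemers D1 lab"
  proof -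
    from D obtain D1 :: "('a ^ 2, ('a ^ 2) set) incidence_structure" and lab where
      *: "points D1 = points affine_plane" "incid D1 = (\<in>)"
        "\<forall>P\<in>parallel_classes. bij_betw (lab P) (points D1) P
           \<and> (\<forall>X\<in>blocks D1. maximal_arc q (quotient_plane P) (lab P ` X))"
        "D = blokhuis_haemers D1 lab"
      unfolding blokhuis_haemers_type_def by blast
    from *(1) have "points D1 = UNIV" by (simp add: affine_plane_def)
    then show ?thesis using that[of D1 lab] * by blast
  qed
  have block: "\<exists>W S. vec.subspace W \<and> vec.dim W = 1 \<and> Z = \<Union>S
      \<and> S \<subseteq> {(+) p ` W | p. True}
      \<and> maximal_arc q (quotient_plane {(+) p ` W | p. True}) S" if Z: "Z \<in> blocks D" for Z
  proof -
    from Z obtain P X where PX: "P \<in> parallel_classes" "X \<in> blocks D1" "Z = \<Union>(lab P ` X)"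
      unfolding D_eq blokhuis_haemers_def by (auto simp: lab(1,2))
    obtain W where W: "vec.subspace W" "vec.dim W = 1" "P = {(+) p ` W | p. True}"
      using PX(1) by (auto simp: parallel_classes_def)
    have "lab P ` X \<subseteq> P" using lab(3)[OF PX(1)] lab(2) by (auto simp: bij_betw_def)
    then show ?thesis
      using W lab(4)[OF PX(1,2)] PX(3) by (intro exI[of _ W] exI[of _ "lab P ` X"]) simp
  qed
  from block[OF B] obtain W S where W: "vec.subspace W" "vec.dim W = 1" and BS: "B = \<Union>S"
    and S: "S \<subseteq> {(+) p ` W | p. True}"
    and arc: "maximal_arc q (quotient_plane {(+) p ` W | p. True}) S" by blast
  from block[OF C] obtain W' S' where W': "vec.subspace W'" "vec.dim W' = 1" and CS: "C = \<Union>S'"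
    and S': "S' \<subseteq> {(+) p ` W' | p. True}"
    and arc': "maximal_arc q (quotient_plane {(+) p ` W' | p. True}) S'" by blast
  show ?thesis
  proof (cases "W = W'")
    case True
    have "B \<inter> C = \<Union>(S \<inter> S')"
    proof
      show "B \<inter> C \<subseteq> \<Union>(S \<inter> S')"
      proof
        fix x assume "x \<in> B \<inter> C"
        then obtain l l' where l: "l \<in> S" "x \<in> l" "l' \<in> S'" "x \<in> l'" unfolding BS CS by auto
        then have "l = (+) x ` W" "l' = (+) x ` W"
          using coset_class_member_eq[OF W(1) S] coset_class_member_eq[OF W'(1) S'] True by blast+
        then show "x \<in> \<Union>(S \<inter> S')" using l by auto
      qed
    qed (auto simp: BS CS)
    then have "q dvd card (B \<inter> C)"
      using dvd_card_Union_cosets[OF W, of "S \<inter> S'"] S q(3) by auto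
    then show ?thesis using q4 by (metis dvd_mult_left)
  next
    case False
    let ?U = "{w + w' | w w'. w \<in> W \<and> w' \<in> W'}"
    note U = vec.subspace_sums[OF W(1) W'(1)] dim_sum_of_distinct_lines(2)[OF W W' False]
    have WU: "W \<subseteq> ?U" "W' \<subseteq> ?U"
      using vec.subspace_0[OF W(1)] vec.subspace_0[OF W'(1)] by force+
    have plane: "4 dvd card (B \<inter> C \<inter> (+) e ` ?U)" for e
    proof -
      let ?E = "(+) e ` ?U"
      have even_count: "2 dvd n" if "n \<in> {0, q div 2}" for n :: nat
        using that q4 by auto
      have count: "card {l \<in> S. l \<subseteq> ?E} \<in> {0, q div 2}"
        using arc coset_mem_quotient_plane[OF W(1) U WU(1), of e]
        by (auto simp: maximal_arc_def quotient_plane_def)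
      have count': "card {l \<in> S'. l \<subseteq> ?E} \<in> {0, q div 2}"
        using arc' coset_mem_quotient_plane[OF W'(1) U WU(2), of e]
        by (auto simp: maximal_arc_def quotient_plane_def)
      have "2 * 2 dvd card {l \<in> S. l \<subseteq> ?E} * card {l \<in> S'. l \<subseteq> ?E}"
        using even_count[OF count] even_count[OF count'] by (rule mult_dvd_mono)
      then show ?thesis
        unfolding BS CS
          card_Int_plane[OF W(1) W'(1) dim_sum_of_distinct_lines(1)[OF W W' False] S S']
        by simp
    qed
    define K where "K e = (+) e ` ?U" for e
    define \<E> where "\<E> = range (\<lambda>e. B \<inter> C \<inter> K e)"
    have K_self: "x \<in> K x" for x unfolding K_def by (rule mem_coset_self[OF U(1)])
    have K_eq: "K e = K x" if "x \<in> K e" for e x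
      using that unfolding K_def by (rule coset_eq_of_mem[OF U(1)])
    have "\<Union>\<E> = B \<inter> C" using K_self by (auto simp: \<E>_def)
    moreover have "4 dvd card (\<Union>\<E>)"
    proof (rule dvd_partition)
      show "\<forall>c1\<in>\<E>. \<forall>c2\<in>\<E>. c1 \<noteq> c2 \<longrightarrow> c1 \<inter> c2 = {}"
        unfolding \<E>_def using K_eq by blast
      show "\<forall>c\<in>\<E>. 4 dvd card c" using plane by (auto simp: \<E>_def K_def)
    qed simp
    ultimately show ?thesis by simp
  qed
qed

theorem theorem4p3:
  fixes q f h :: nat
    and D :: "('a::{field,finite} ^ 3, ('a ^ 3) set) incidence_structure"
    and G :: "(('a ^ 3 \<Rightarrow> 'a ^ 3) \<times> (('a ^ 3) set \<Rightarrow> ('a ^ 3) set)) set"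
    and M :: "('a ^ 3) set \<Rightarrow> ('a ^ 3) set set \<Rightarrow> nat"
  assumes "q \<ge> 4" and "\<exists>m. q = 2 ^ m" and "CARD('a) = q"
    and "blokhuis_haemers_type q D" and "quasi_symmetric_design D"
    and "subgroup G (Aut D)"
    and "card (fixed_points D G) = f" and "card (fixed_blocks D G) = h"
    and "\<forall>P\<in>nonfixed_point_orbits D G. card P = 2"
    and "\<forall>B\<in>nonfixed_block_orbits D G. card B = 2"
    and "M = point_orbit_matrix D"
  defines "I \<equiv> nonfixed_point_orbits D G"
  defines "C \<equiv> column_code I (nonfixed_block_orbits D G) (\<lambda>P B. of_nat (M P B))"
  shows "doubly_even I C \<and> self_orthogonal I C"
proof -
  interpret two_orbit_group D G
  proof (rule two_orbit_group.intro)
    show "finite (points D)" by simp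
  qed (fact assms)+
  have D: "points D = UNIV" "incid D = (\<in>)"
    using assms(4) by (auto simp: blokhuis_haemers_type_def blokhuis_haemers_def affine_plane_def)
  obtain m where m: "q = 2 ^ m" using assms(2) by blast
  have "4 dvd card {p \<in> points D. incid D p B \<and> incid D p B'}"
    if "B \<in> blocks D" "B' \<in> blocks D" for B B'
    using four_dvd_block_intersection[OF assms(1) m assms(3,4) that] by (simp add: D Int_def)
  then show ?thesis
    unfolding C_def I_def \<open>M = point_orbit_matrix D\<close> by (rule orbit_matrix_code)
qed

end
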